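(* Let $m,n,r$ be positive integers with $r\le m\le n$, let $X=\{(i,j) : 1\le i\le m,\ 1\le j\le n\}$, and let $Y$ be a two-sided sub-region of $X$. Let $P_1,\dots,P_r$ and $Q_1,\dots,Q_r$ be points of $Y$ such that: (i) $P_i=(a_i,n)$ with $1=a_1<a_2<\cdots<a_r\le m$; (ii) $Q_i=(c_i,d_i)$ with $1\le c_1\le\cdots\le c_r=m$ and $1=d_1<d_2<\cdots<d_r\le n$; (iii) if $(1,1)\notin Y$, then $(c_1-1,1)\in Y$. Then the number of $r$-tuples $(C_1,\dots,C_r)$ of pairwise disjoint (non-intersecting) paths in $Y$, where $C_i$ is a path from $P_i$ to $Q_i$ for $i=1,\dots,r$, equals $$\det\big[w(P_i,Q_j)\big]_{i,j=1,\dots,r},$$ where $w(P,Q)$ denotes the number of paths in $Y$ from $P$ to $Q$.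
   Context: Partial order on $X$: $(i,j)\le(i',j')$ iff $i\ge i'$ and $j\le j'$. For $P,Q\in X$ with $P\ge Q$, a path from $P$ to $Q$ is a maximal chain in $X$ with endpoints $P$ and $Q$ (so a sequence of unit steps, each increasing the first coordinate by $1$ or decreasing the second coordinate by $1$). A path in $Y$ is a path all of whose points lie in $Y$; $w(P,Q)=0$ if there is no path from $P$ to $Q$ in $Y$. Two paths are non-intersecting if they are disjoint as sets of points. Two-sided sub-region: let $C_{k_1,k_2}$ be a path from $(k_1,n)$ to $(m,k_2)$ with $1<k_1\le m$, $1<k_2\le n$, and let $\tilde C_{k_3,k_4}$ be a path from $(1,k_3)$ to $(k_4,1)$ with $1\le k_3<n$, $1\le k_4<m$. The two-sided sub-region (sub-ladder) $Y$ of $X$ determined by $C_{k_1,k_2}$ and $\tilde C_{k_3,k_4}$ is the part of $X$ bounded by the lines $x=1$, $x=m$, $y=1$, $y=n$ and the two paths, boundary included. That is, $(i,j)\in X$ is in $Y$ iff there is $(i',j')\in C_{k_1,k_2}$ with $i\le i'$, $j\le j'$ and there is $(i'',j'')\in\tilde C_{k_3,k_4}$ with $i''\le i$, $j''\le j$. *)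

theory Defs
  imports Main "HOL-Library.FuncSet" "HOL-Library.Disjoint_Sets" "Jordan_Normal_Form.Determinant"
begin

type_synonym point = "nat \<times> nat"

definition grid :: "nat \<Rightarrow> nat \<Rightarrow> point set" where
  "grid m n = {1..m} \<times> {1..n}"

definition point_le :: "point \<Rightarrow> point \<Rightarrow> bool" (infix "\<preceq>" 50) where
  "p \<preceq> q \<longleftrightarrow> fst p \<ge> fst q \<and> snd p \<le> snd q"

definition chain_between :: "nat \<Rightarrow> nat \<Rightarrow> point \<Rightarrow> point \<Rightarrow> point set \<Rightarrow> bool" where
  "chain_between m n P Q C \<longleftrightarrow>
     pred_on.chain (grid m n) (\<preceq>) C \<and> P \<in> C \<and> Q \<in> C \<and> (\<forall>Z\<in>C. Q \<preceq> Z \<and> Z \<preceq> P)"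

text \<open>A path is a set of points: a maximal chain of the grid among those with greatest element
  \<open>P\<close> and least element \<open>Q\<close>. No path exists unless \<open>Q \<preceq> P\<close> and both points lie in the grid.\<close>

definition lattice_path :: "nat \<Rightarrow> nat \<Rightarrow> point \<Rightarrow> point \<Rightarrow> point set \<Rightarrow> bool" where
  "lattice_path m n P Q C \<longleftrightarrow>
     chain_between m n P Q C \<and> (\<forall>D. chain_between m n P Q D \<and> C \<subseteq> D \<longrightarrow> D = C)"

text \<open>Maximality of a path in \<open>Y\<close> refers to chains of the whole grid, not only to chains
  contained in \<open>Y\<close>.\<close>

definition paths_in :: "nat \<Rightarrow> nat \<Rightarrow> point set \<Rightarrow> point \<Rightarrow> point \<Rightarrow> point set set" where
  "paths_in m n Y P Q = {C. lattice_path m n P Q C \<and> C \<subseteq> Y}"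

definition path_count :: "nat \<Rightarrow> nat \<Rightarrow> point set \<Rightarrow> point \<Rightarrow> point \<Rightarrow> nat" where
  "path_count m n Y P Q = card (paths_in m n Y P Q)"

definition region_between :: "nat \<Rightarrow> nat \<Rightarrow> point set \<Rightarrow> point set \<Rightarrow> point set" where
  "region_between m n U L =
     {(i, j) \<in> grid m n. (\<exists>(i', j')\<in>U. i \<le> i' \<and> j \<le> j') \<and> (\<exists>(i'', j'')\<in>L. i'' \<le> i \<and> j'' \<le> j)}"

definition two_sided_subregion :: "nat \<Rightarrow> nat \<Rightarrow> point set \<Rightarrow> bool" where
  "two_sided_subregion m n Y \<longleftrightarrow>
     (\<exists>k1 k2 k3 k4 U L.
        1 < k1 \<and> k1 \<le> m \<and> 1 < k2 \<and> k2 \<le> n \<and> 1 \<le> k3 \<and> k3 < n \<and> 1 \<le> k4 \<and> k4 < m \<and>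
        lattice_path m n (k1, n) (m, k2) U \<and> lattice_path m n (1, k3) (k4, 1) L \<and>
        Y = region_between m n U L)"

definition nonintersecting_tuples ::
  "nat \<Rightarrow> nat \<Rightarrow> point set \<Rightarrow> nat \<Rightarrow> (nat \<Rightarrow> point) \<Rightarrow> (nat \<Rightarrow> point) \<Rightarrow> (nat \<Rightarrow> point set) set" where
  "nonintersecting_tuples m n Y r P Q =
     {C \<in> (\<Pi>\<^sub>E i\<in>{1..r}. paths_in m n Y (P i) (Q i)). disjoint_family_on C {1..r}}"

end

theory Submission
  imports Defs
begin

text \<open>
  This is the Lindstroem--Gessel--Viennot argument. Expanding the determinant counts pairs of a
  permutation and a tuple of paths with permuted endpoints, weighted by the sign. If a tuple
  intersects, exchange the final segments of two paths through a common point \<open>z\<close>. The exchange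
  does not alter the set of points lying on several paths, nor the set of indices of the paths
  through \<open>z\<close>. Hence choosing \<open>z\<close> and the two paths as a function of these sets alone
  makes the exchange a sign-reversing involution. What remains are the disjoint tuples, and the
  position of the endpoints forces their permutation to be the identity: by a discrete intermediate
  value argument along the rank \<open>x - y\<close>, two paths with exchanged endpoints meet.
\<close>

section \<open>Lattice paths as maximal chains\<close>

lemma point_le_refl [simp]: "p \<preceq> p"
  by (simp add: point_le_def)

lemma point_le_trans: "p \<preceq> q \<Longrightarrow> q \<preceq> s \<Longrightarrow> p \<preceq> s"
  by (auto simp: point_le_def)

lemma point_le_antisym: "p \<preceq> q \<Longrightarrow> q \<preceq> p \<Longrightarrow> p = q"
  by (auto simp: point_le_def prod_eq_iff)

lemma chain_between_iff:
  "chain_between m n P Q C \<longleftrightarrow>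
     C \<subseteq> grid m n \<and> (\<forall>x\<in>C. \<forall>y\<in>C. x \<preceq> y \<or> y \<preceq> x) \<and> P \<in> C \<and> Q \<in> C \<and>
     (\<forall>z\<in>C. Q \<preceq> z \<and> z \<preceq> P)"
proof -
  have "(\<preceq>)\<^sup>=\<^sup>= = (\<preceq>)"
    by (auto simp: fun_eq_iff)
  then show ?thesis
    by (simp add: chain_between_def pred_on.chain_def)
qed

lemma lattice_path_chain_between: "lattice_path m n P Q C \<Longrightarrow> chain_between m n P Q C"
  by (simp add: lattice_path_def)

lemma lattice_path_comparable:
  "lattice_path m n P Q C \<Longrightarrow> x \<in> C \<Longrightarrow> y \<in> C \<Longrightarrow> x \<preceq> y \<or> y \<preceq> x"
  using lattice_path_chain_between unfolding chain_between_iff by blast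

lemma lattice_path_maximal:
  "lattice_path m n P Q C \<Longrightarrow> chain_between m n P Q D \<Longrightarrow> C \<subseteq> D \<Longrightarrow> D = C"
  by (simp add: lattice_path_def)

lemma finite_paths_in: "finite (paths_in m n Y P Q)"
proof -
  have "paths_in m n Y P Q \<subseteq> Pow (grid m n)"
    by (auto simp: paths_in_def dest!: lattice_path_chain_between simp: chain_between_iff)
  then show ?thesis
    by (rule finite_subset) (simp add: grid_def)
qed

section \<open>Exchanging final segments\<close>

text \<open>Paths descend in \<open>\<preceq>\<close>, so this follows \<open>A\<close> from its
  start down to \<open>z\<close> and then \<open>B\<close> from \<open>z\<close> to its end.\<close>

definition crossover :: "point \<Rightarrow> point set \<Rightarrow> point set \<Rightarrow> point set" where
  "crossover z A B = {p \<in> A. z \<preceq> p} \<union> {p \<in> B. p \<preceq> z}"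

lemma crossover_self:
  assumes "lattice_path m n P Q A" "z \<in> A"
  shows "crossover z A A = A"
  using lattice_path_comparable[OF assms(1) _ assms(2)] by (auto simp: crossover_def)

lemma crossover_crossover:
  assumes "z \<in> A" "z \<in> B"
  shows "crossover z (crossover z A B) (crossover z B A) = crossover z A A"
  using assms by (auto simp: crossover_def dest: point_le_antisym)

lemma chain_between_crossover:
  assumes A: "chain_between m n P Q A" and B: "chain_between m n P' Q' B"
    and z: "z \<in> A" "z \<in> B"
  shows "chain_between m n P Q' (crossover z A B)"
proof -
  have "x \<preceq> y \<or> y \<preceq> x" if "x \<in> crossover z A B" "y \<in> crossover z A B" for x y
    using that A B unfolding crossover_def chain_between_iff by (blast intro: point_le_trans)
  moreover have "P \<in> crossover z A B" "Q' \<in> crossover z A B" "crossover z A B \<subseteq> grid m n"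
    using A B z unfolding crossover_def chain_between_iff by blast+
  moreover have "Q' \<preceq> x \<and> x \<preceq> P" if "x \<in> crossover z A B" for x
  proof -
    have "Q' \<preceq> z" "z \<preceq> P"
      using A B z unfolding chain_between_iff by blast+
    then show ?thesis
      using that A B point_le_trans unfolding crossover_def chain_between_iff by blast
  qed
  ultimately show ?thesis
    unfolding chain_between_iff by blast
qed

text \<open>If a chain \<open>D\<close> extends the grafted path, the part of \<open>D\<close> above
  \<open>z\<close> continued along \<open>A\<close> is a chain extending \<open>A\<close>, hence is
  \<open>A\<close> itself; symmetrically, \<open>B\<close> determines the part of \<open>D\<close>
  below \<open>z\<close>. Every point of \<open>D\<close> is comparable to \<open>z\<close>, so
  these two parts exhaust \<open>D\<close>.\<close>

lemma lattice_path_crossover: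
  assumes A: "lattice_path m n P Q A" and B: "lattice_path m n P' Q' B"
    and z: "z \<in> A" "z \<in> B"
  shows "lattice_path m n P Q' (crossover z A B)"
  unfolding lattice_path_def
proof (intro conjI allI impI)
  note chA = lattice_path_chain_between[OF A] and chB = lattice_path_chain_between[OF B]
  show "chain_between m n P Q' (crossover z A B)"
    by (rule chain_between_crossover[OF chA chB z])
  fix D
  assume D: "chain_between m n P Q' D \<and> crossover z A B \<subseteq> D"
  have zD: "z \<in> D"
    using D z by (auto simp: crossover_def)
  have "crossover z D A = A"
  proof (rule lattice_path_maximal[OF A])
    show "chain_between m n P Q (crossover z D A)"
      using chain_between_crossover[OF _ chA zD z(1)] D by blast
    show "A \<subseteq> crossover z D A"
      using D lattice_path_comparable[OF A _ z(1)] by (auto simp: crossover_def)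
  qed
  moreover have "crossover z B D = B"
  proof (rule lattice_path_maximal[OF B])
    show "chain_between m n P' Q' (crossover z B D)"
      using chain_between_crossover[OF chB _ z(2) zD] D by blast
    show "B \<subseteq> crossover z B D"
      using D lattice_path_comparable[OF B _ z(2)] by (auto simp: crossover_def)
  qed
  moreover have "x \<preceq> z \<or> z \<preceq> x" if "x \<in> D" for x
    using D zD that by (auto simp: chain_between_iff)
  ultimately have "D \<subseteq> crossover z A B"
    by (auto simp: crossover_def)
  with D show "D = crossover z A B"
    by blast
qed

lemma crossover_in_paths_in:
  assumes "A \<in> paths_in m n Y P Q" "B \<in> paths_in m n Y P' Q'" "z \<in> A" "z \<in> B"
  shows "crossover z A B \<in> paths_in m n Y P Q'"
  using assms lattice_path_crossover[of m n P Q A P' Q' B z]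
  by (auto simp: paths_in_def crossover_def)

definition tail_swap :: "point \<Rightarrow> nat \<Rightarrow> nat \<Rightarrow> (nat \<Rightarrow> point set) \<Rightarrow> nat \<Rightarrow> point set" where
  "tail_swap z i j C = C(i := crossover z (C i) (C j), j := crossover z (C j) (C i))"

lemma tail_swap_tail_swap:
  assumes "i \<noteq> j" "lattice_path m n P Q (C i)" "lattice_path m n P' Q' (C j)"
    and "z \<in> C i" "z \<in> C j"
  shows "tail_swap z i j (tail_swap z i j C) = C"
  using assms
  by (auto simp: tail_swap_def fun_eq_iff crossover_crossover crossover_self)

text \<open>Strictly below \<open>z\<close> the exchange swaps the labels \<open>i\<close> and
  \<open>j\<close>. Elsewhere it changes nothing, since \<open>z\<close> lies on both paths and all
  their points are comparable to \<open>z\<close>.\<close>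

lemma tail_swap_incidence:
  assumes ij: "i \<noteq> j" and paths: "lattice_path m n P Q (C i)" "lattice_path m n P' Q' (C j)"
    and z: "z \<in> C i" "z \<in> C j"
  shows "y \<in> tail_swap z i j C k \<longleftrightarrow>
    y \<in> C (if y \<preceq> z \<and> y \<noteq> z then transpose i j k else k)"
proof -
  have "y \<preceq> z \<or> z \<preceq> y" if "y \<in> C i \<or> y \<in> C j"
    using that lattice_path_comparable[OF paths(1) _ z(1)]
      lattice_path_comparable[OF paths(2) _ z(2)] by blast
  then show ?thesis
    using ij z by (auto simp: tail_swap_def crossover_def transpose_def dest: point_le_antisym)
qed

section \<open>Points shared by several paths\<close>

definition multipoints :: "nat set \<Rightarrow> (nat \<Rightarrow> point set) \<Rightarrow> point set" where
  "multipoints I C = {z. \<exists>i\<in>I. \<exists>j\<in>I. i \<noteq> j \<and> z \<in> C i \<and> z \<in> C j}"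

lemma disjoint_family_on_iff_multipoints:
  "disjoint_family_on C I \<longleftrightarrow> multipoints I C = {}"
  by (auto simp: disjoint_family_on_def multipoints_def)

text \<open>Strictly below \<open>z\<close> the family is merely relabelled by a transposition of
  \<open>I\<close>, and lying on two differently labelled paths is unaffected by
  relabelling.\<close>

lemma multipoints_tail_swap:
  assumes I: "i \<in> I" "j \<in> I" and ij: "i \<noteq> j"
    and paths: "lattice_path m n P Q (C i)" "lattice_path m n P' Q' (C j)"
    and z: "z \<in> C i" "z \<in> C j"
  shows "multipoints I (tail_swap z i j C) = multipoints I C"
proof (rule Set.set_eqI)
  fix y
  show "y \<in> multipoints I (tail_swap z i j C) \<longleftrightarrow> y \<in> multipoints I C"
  proof (cases "y \<preceq> z \<and> y \<noteq> z")
    case True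
    let ?t = "transpose i j"
    have t: "?t k \<in> I" if "k \<in> I" for k
      using that I by (auto simp: transpose_def)
    have "y \<in> multipoints I (tail_swap z i j C) \<longleftrightarrow>
        (\<exists>k\<in>I. \<exists>l\<in>I. k \<noteq> l \<and> y \<in> C (?t k) \<and> y \<in> C (?t l))"
      unfolding multipoints_def using True
      by (simp add: tail_swap_incidence[OF ij paths z])
    also have "\<dots> \<longleftrightarrow> (\<exists>k\<in>I. \<exists>l\<in>I. k \<noteq> l \<and> y \<in> C k \<and> y \<in> C l)"
      using t by (metis transpose_involutory)
    finally show ?thesis
      by (simp add: multipoints_def)
  next
    case False
    then have "y \<in> tail_swap z i j C k \<longleftrightarrow> y \<in> C k" for k
      using tail_swap_incidence[OF ij paths z] by presburger
    then show ?thesis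
      by (simp add: multipoints_def)
  qed
qed

section \<open>The sign-reversing involution\<close>

definition swap_point :: "nat set \<Rightarrow> (nat \<Rightarrow> point set) \<Rightarrow> point" where
  "swap_point I C = (SOME z. z \<in> multipoints I C)"

definition swap_indices :: "nat set \<Rightarrow> (nat \<Rightarrow> point set) \<Rightarrow> nat \<times> nat" where
  "swap_indices I C =
    (SOME (i, j). i \<noteq> j \<and> {i, j} \<subseteq> {k \<in> I. swap_point I C \<in> C k})"

text \<open>The transposition acts first: after the exchange, path \<open>i\<close> ends where path
  \<open>j\<close> ended, at the endpoint with index \<open>\<sigma> j\<close>.\<close>

definition swap_perm :: "nat set \<Rightarrow> (nat \<Rightarrow> nat) \<times> (nat \<Rightarrow> point set) \<Rightarrow> nat \<Rightarrow> nat" where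
  "swap_perm I = (\<lambda>(\<sigma>, C). case swap_indices I C of (i, j) \<Rightarrow> \<sigma> \<circ> transpose i j)"

definition swap_paths :: "nat set \<Rightarrow> (nat \<Rightarrow> nat) \<times> (nat \<Rightarrow> point set) \<Rightarrow> nat \<Rightarrow> point set" where
  "swap_paths I = (\<lambda>(\<sigma>, C). case swap_indices I C of (i, j) \<Rightarrow> tail_swap (swap_point I C) i j C)"

lemma swap_indices:
  assumes "multipoints I C \<noteq> {}" "swap_indices I C = (i, j)"
  shows "i \<noteq> j" "i \<in> I" "j \<in> I" "swap_point I C \<in> C i" "swap_point I C \<in> C j"
proof -
  have "swap_point I C \<in> multipoints I C"
    unfolding swap_point_def using assms(1) by (simp add: some_in_eq)
  then have ex: "\<exists>ij. case ij of (i, j) \<Rightarrow> i \<noteq> j \<and> {i, j} \<subseteq> {k \<in> I. swap_point I C \<in> C k}"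
    by (auto simp: multipoints_def)
  have "case swap_indices I C of (i, j) \<Rightarrow> i \<noteq> j \<and> {i, j} \<subseteq> {k \<in> I. swap_point I C \<in> C k}"
    unfolding swap_indices_def by (rule someI_ex[OF ex])
  then show "i \<noteq> j" "i \<in> I" "j \<in> I" "swap_point I C \<in> C i" "swap_point I C \<in> C j"
    using assms(2) by auto
qed

definition path_tuples ::
  "nat \<Rightarrow> nat \<Rightarrow> point set \<Rightarrow> nat set \<Rightarrow> (nat \<Rightarrow> point) \<Rightarrow> (nat \<Rightarrow> point) \<Rightarrow> (nat \<Rightarrow> point set) set"
  where "path_tuples m n Y I p q = (\<Pi>\<^sub>E i\<in>I. paths_in m n Y (p i) (q i))"

lemma finite_path_tuples: "finite I \<Longrightarrow> finite (path_tuples m n Y I p q)"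
  by (simp add: path_tuples_def finite_PiE finite_paths_in)

text \<open>The permutation is carried along because \<open>C\<close> alone need not determine it
  when \<open>q\<close> takes a value twice.\<close>

definition crossing_configs ::
  "nat \<Rightarrow> nat \<Rightarrow> point set \<Rightarrow> nat set \<Rightarrow> (nat \<Rightarrow> point) \<Rightarrow> (nat \<Rightarrow> point) \<Rightarrow>
    ((nat \<Rightarrow> nat) \<times> (nat \<Rightarrow> point set)) set" where
  "crossing_configs m n Y I p q =
    (SIGMA \<sigma>:{\<sigma>. \<sigma> permutes I}. {C \<in> path_tuples m n Y I p (q \<circ> \<sigma>). \<not> disjoint_family_on C I})"

text \<open>The exchanged family has the same multiple points and the same paths through the chosen
  one, so the second application selects the same \<open>z\<close>, \<open>i\<close> and
  \<open>j\<close> and undoes the first. The transposition flips the sign.\<close>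

lemma swap_crossing_config:
  assumes I: "finite I" and x: "(\<sigma>, C) \<in> crossing_configs m n Y I p q"
  defines "y \<equiv> (swap_perm I (\<sigma>, C), swap_paths I (\<sigma>, C))"
  shows "y \<in> crossing_configs m n Y I p q"
    and "(swap_perm I y, swap_paths I y) = (\<sigma>, C)"
    and "sign (swap_perm I (\<sigma>, C)) = - sign \<sigma>"
proof -
  have \<sigma>: "\<sigma> permutes I" and C: "C \<in> path_tuples m n Y I p (q \<circ> \<sigma>)"
    and ne: "multipoints I C \<noteq> {}"
    using x by (auto simp: crossing_configs_def disjoint_family_on_iff_multipoints)
  define z where "z = swap_point I C"
  obtain i j where ij_def: "swap_indices I C = (i, j)"
    by fastforce
  note ij = swap_indices[OF ne ij_def, folded z_def]
  define C' where "C' = tail_swap z i j C"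
  have y: "y = (\<sigma> \<circ> transpose i j, C')"
    by (simp add: y_def swap_perm_def swap_paths_def ij_def C'_def z_def)
  have C_in: "C k \<in> paths_in m n Y (p k) (q (\<sigma> k))" if "k \<in> I" for k
    using C that by (auto simp: path_tuples_def)
  have path: "lattice_path m n (p k) (q (\<sigma> k)) (C k)" if "k \<in> I" for k
    using C_in[OF that] by (simp add: paths_in_def)
  note inc = tail_swap_incidence[OF ij(1) path[OF ij(2)] path[OF ij(3)] ij(4,5), folded C'_def]
  have mult: "multipoints I C' = multipoints I C"
    unfolding C'_def
    by (rule multipoints_tail_swap[OF ij(2,3,1) path[OF ij(2)] path[OF ij(3)] ij(4,5)])
  have t: "transpose i j permutes I"
    using ij(2,3) by (rule permutes_swap_id)
  have "C' k \<in> paths_in m n Y (p k) (q (\<sigma> (transpose i j k)))" if "k \<in> I" for k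
    using that C_in ij crossover_in_paths_in[OF C_in[OF ij(2)] C_in[OF ij(3)] ij(4,5)]
      crossover_in_paths_in[OF C_in[OF ij(3)] C_in[OF ij(2)] ij(5,4)]
    by (auto simp: C'_def tail_swap_def transpose_def)
  moreover have "C' k = undefined" if "k \<notin> I" for k
    using that C ij(2,3) by (auto simp: C'_def tail_swap_def path_tuples_def)
  ultimately have "C' \<in> path_tuples m n Y I p (q \<circ> (\<sigma> \<circ> transpose i j))"
    by (auto simp: path_tuples_def)
  then show "y \<in> crossing_configs m n Y I p q"
    using permutes_compose[OF t \<sigma>] mult ne
    by (simp add: y crossing_configs_def disjoint_family_on_iff_multipoints)
  have z': "swap_point I C' = z"
    by (simp add: swap_point_def z_def mult)
  \<comment> \<open>The point \<open>z\<close> is not strictly below itself, so \<open>inc\<close>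
    gives \<open>z \<in> C' k\<close> iff \<open>z \<in> C k\<close>; both choices are thus made
    from the same predicate.\<close>
  have "swap_indices I C' = (i, j)"
    unfolding ij_def[symmetric] swap_indices_def z' z_def[symmetric] by (simp add: inc)
  then show "(swap_perm I y, swap_paths I y) = (\<sigma>, C)"
    using tail_swap_tail_swap[OF ij(1) path[OF ij(2)] path[OF ij(3)] ij(4,5), folded C'_def]
    by (simp add: y swap_perm_def swap_paths_def z' comp_assoc)
  have "sign (\<sigma> \<circ> transpose i j) = - sign \<sigma>"
    using ij(1) permutes_imp_permutation[OF I \<sigma>]
    by (simp add: sign_compose permutation_swap_id sign_swap_id)
  then show "sign (swap_perm I (\<sigma>, C)) = - sign \<sigma>"
    using y by (simp add: y_def)
qed

text \<open>Reindexing along the involution shows that this integer sum equals its own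
  negative.\<close>

lemma sum_sign_crossing_configs:
  assumes "finite I"
  shows "(\<Sum>(\<sigma>, C)\<in>crossing_configs m n Y I p q. sign \<sigma>) = 0"
proof -
  let ?S = "crossing_configs m n Y I p q" and ?f = "\<lambda>x. (swap_perm I x, swap_paths I x)"
  have inv: "?f x \<in> ?S" "?f (?f x) = x" "sign (fst (?f x)) = - sign (fst x)" if "x \<in> ?S" for x
    using swap_crossing_config[OF assms, of "fst x" "snd x"] that by simp_all
  have "(\<Sum>x\<in>?S. sign (fst x)) = (\<Sum>x\<in>?S. - sign (fst x))"
    by (rule sum.reindex_bij_witness[of _ ?f ?f]) (use inv in simp_all)
  then show ?thesis
    by (simp add: sum_negf case_prod_beta)
qed

text \<open>Each product counts the tuples for \<open>\<sigma>\<close>, which split into disjoint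
  and crossing ones; the signed count of the crossing ones vanishes. The position of the endpoints
  has not entered yet, so disjoint tuples of every permutation remain.\<close>

theorem lindstroem_gessel_viennot:
  assumes I: "finite I"
  shows "(\<Sum>\<sigma> | \<sigma> permutes I. sign \<sigma> * (\<Prod>i\<in>I. int (path_count m n Y (p i) (q (\<sigma> i))))) =
    (\<Sum>\<sigma> | \<sigma> permutes I. sign \<sigma> *
      int (card {C \<in> path_tuples m n Y I p (q \<circ> \<sigma>). disjoint_family_on C I}))"
proof -
  let ?T = "\<lambda>\<sigma>. path_tuples m n Y I p (q \<circ> \<sigma>)"
  let ?N = "\<lambda>\<sigma>. {C \<in> ?T \<sigma>. disjoint_family_on C I}"
  let ?X = "\<lambda>\<sigma>. {C \<in> ?T \<sigma>. \<not> disjoint_family_on C I}"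
  have fin: "finite (?T \<sigma>)" for \<sigma>
    using I by (rule finite_path_tuples)
  have "(\<Prod>i\<in>I. int (path_count m n Y (p i) (q (\<sigma> i)))) = int (card (?T \<sigma>))" for \<sigma>
    using I by (simp add: path_tuples_def card_PiE path_count_def)
  moreover have "card (?T \<sigma>) = card (?N \<sigma>) + card (?X \<sigma>)" for \<sigma>
    using fin[of \<sigma>] by (subst card_Un_disjoint[symmetric]) (auto intro: arg_cong[where f = card])
  moreover have "(\<Sum>\<sigma> | \<sigma> permutes I. sign \<sigma> * int (card (?X \<sigma>))) = 0"
  proof -
    have "(\<Sum>\<sigma> | \<sigma> permutes I. sign \<sigma> * int (card (?X \<sigma>))) =
        (\<Sum>\<sigma> | \<sigma> permutes I. \<Sum>C\<in>?X \<sigma>. sign \<sigma>)"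
      by (simp add: mult.commute)
    also have "\<dots> = (\<Sum>(\<sigma>, C)\<in>crossing_configs m n Y I p q. sign \<sigma>)"
      unfolding crossing_configs_def
      by (rule sum.Sigma) (use I fin finite_permutations in auto)
    finally show ?thesis
      by (simp add: sum_sign_crossing_configs[OF I])
  qed
  ultimately show ?thesis
    by (simp add: distrib_left sum.distrib)
qed

section \<open>Paths with exchanged endpoints meet\<close>

text \<open>Either kind of unit step raises this by exactly one, so it serves as the time parameter
  along a path.\<close>

definition rank :: "point \<Rightarrow> int" where
  "rank p = int (fst p) - int (snd p)"

lemma rank_inj:
  assumes "rank p = rank q" "fst p = fst q"
  shows "p = q"
  using assms by (simp add: rank_def prod_eq_iff)

lemma comparable_rank_eq:
  assumes "p \<preceq> q \<or> q \<preceq> p" "rank p = rank q"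
  shows "p = q"
  using assms by (auto simp: rank_def point_le_def prod_eq_iff)

text \<open>This turns maximality into unit steps: a gap between \<open>p\<close> and its successor
  in the chain could be filled by a grid point next to \<open>p\<close>.\<close>

lemma lattice_path_step:
  assumes C: "lattice_path m n P Q C" and p: "p \<in> C" "p \<noteq> Q"
  obtains "(fst p + 1, snd p) \<in> C" | "(fst p, snd p - 1) \<in> C" "1 < snd p"
proof -
  note ch = lattice_path_chain_between[OF C, unfolded chain_between_iff]
  let ?S = "{w \<in> C. w \<preceq> p \<and> w \<noteq> p}"
  have "finite C"
    using ch finite_subset[of C "grid m n"] by (simp add: grid_def)
  moreover have "Q \<in> ?S"
    using ch p by blast
  \<comment> \<open>The rank grows on the way down the chain, so the point of least rank strictly
    below \<open>p\<close> is its immediate successor.\<close>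
  ultimately obtain w where w: "w \<in> ?S" and min: "\<And>v. v \<in> ?S \<Longrightarrow> rank w \<le> rank v"
    using ex_min_if_finite[of "rank ` ?S"]
    by (smt (verit) arg_min_if_finite(1) arg_min_least empty_iff finite_Collect_conjI
        finite_subset mem_Collect_eq subsetI)
  have below: "v \<preceq> w" if "v \<in> ?S" for v
    using that w min[OF that] ch by (fastforce simp: rank_def point_le_def)
  \<comment> \<open>Any \<open>u\<close> between \<open>w\<close> and \<open>p\<close> is comparable
    to the whole chain, as no chain point lies strictly between them; maximality then puts
    \<open>u\<close> into \<open>C\<close>.\<close>
  have mem: "u \<in> C" if u: "w \<preceq> u" "u \<preceq> p" for u
  proof -
    have comp: "v \<preceq> u \<or> u \<preceq> v" if "v \<in> C" for v
    proof (cases "v \<in> ?S")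
      case True
      then show ?thesis
        using below u(1) point_le_trans by blast
    next
      case False
      then have "p \<preceq> v"
        using that ch p(1) by (metis (mono_tags, lifting) mem_Collect_eq)
      then show ?thesis
        using u(2) point_le_trans by blast
    qed
    have "w \<in> grid m n" "p \<in> grid m n"
      using ch w p by auto
    then have "u \<in> grid m n"
      using u by (cases u; cases w; cases p) (simp add: grid_def point_le_def)
    moreover have "Q \<preceq> u \<and> u \<preceq> P"
      using ch w p u by (blast intro: point_le_trans)
    ultimately have "chain_between m n P Q (insert u C)"
      using ch comp unfolding chain_between_iff by auto
    from lattice_path_maximal[OF C this] show ?thesis
      by blast
  qed
  have wp: "w \<preceq> p" "w \<noteq> p" and w1: "1 \<le> snd w"
    using w ch by (auto simp: grid_def)
  show thesis
  proof (cases "fst p < fst w")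
    case True
    then show ?thesis
      using wp that(1) mem[of "(fst p + 1, snd p)"] by (simp add: point_le_def)
  next
    case False
    \<comment> \<open>Together with \<open>w1\<close> this gives \<open>1 < snd p\<close>, so the
      natural-number subtraction in \<open>snd p - 1\<close> is not truncated.\<close>
    then have "snd w < snd p" "fst w = fst p"
      using wp by (auto simp: point_le_def prod_eq_iff)
    then show ?thesis
      using w1 that(2) mem[of "(fst p, snd p - 1)"] by (simp add: point_le_def)
  qed
qed

section \<open>Parametrization of a path by rank\<close>

lemma lattice_path_rank_exists:
  assumes C: "lattice_path m n P Q C" and "rank P + int k \<le> rank Q"
  shows "\<exists>p\<in>C. rank p = rank P + int k"
  using assms(2)
proof (induction k)
  case 0
  then show ?case
    using lattice_path_chain_between[OF C] by (auto simp: chain_between_iff)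
next
  case (Suc k)
  then obtain p where p: "p \<in> C" "rank p = rank P + int k"
    by auto
  with Suc.prems have "p \<noteq> Q"
    by auto
  from C p(1) this show ?case
    by (rule lattice_path_step) (use p(2) in \<open>force simp: rank_def\<close>)+
qed

text \<open>Arbitrary if no point of \<open>C\<close> has rank \<open>t\<close>.\<close>

definition abscissa :: "point set \<Rightarrow> int \<Rightarrow> nat" where
  "abscissa C t = (SOME x. \<exists>p\<in>C. rank p = t \<and> fst p = x)"

text \<open>Comparable points of equal rank coincide, so a path has at most one point of each rank
  and the choice is forced.\<close>

lemma abscissa_eq:
  assumes C: "lattice_path m n P Q C" and p: "p \<in> C"
  shows "abscissa C (rank p) = fst p"
  unfolding abscissa_def
  using p lattice_path_comparable[OF C] comparable_rank_eq
  by (intro some_equality) metis+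

lemma lattice_path_rank_point:
  assumes C: "lattice_path m n P Q C" and t: "rank P \<le> t" "t \<le> rank Q"
  obtains p where "p \<in> C" "rank p = t" "fst p = abscissa C t"
  using lattice_path_rank_exists[OF C, of "nat (t - rank P)"] abscissa_eq[OF C] t
  by auto

text \<open>This is the discrete continuity behind the intermediate value argument: a horizontal
  step adds one, a vertical step adds nothing.\<close>

lemma abscissa_step:
  assumes C: "lattice_path m n P Q C" and t: "rank P \<le> t" "t < rank Q"
  shows "abscissa C (t + 1) = abscissa C t \<or> abscissa C (t + 1) = abscissa C t + 1"
proof -
  obtain p where p: "p \<in> C" "rank p = t" "fst p = abscissa C t"
    using lattice_path_rank_point[OF C t(1)] t(2) by auto
  then have "p \<noteq> Q"
    using t(2) by auto
  with C p(1) show ?thesis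
  proof (rule lattice_path_step)
    assume "(fst p + 1, snd p) \<in> C"
    from abscissa_eq[OF C this] show ?thesis
      using p by (simp add: rank_def algebra_simps)
  next
    assume "(fst p, snd p - 1) \<in> C" "1 < snd p"
    with abscissa_eq[OF C this(1)] show ?thesis
      using p by (simp add: rank_def algebra_simps of_nat_diff)
  qed
qed

text \<open>At equal rank, \<open>A\<close> starts weakly to the left of \<open>B\<close> and ends
  weakly to its right. The difference of abscissas moves by at most one per step, so it vanishes
  somewhere; equal rank and equal abscissa mean a common point.\<close>

lemma lattice_paths_meet:
  assumes A: "lattice_path m n (a, n) (c', d') A" and B: "lattice_path m n (a', n) (c, d) B"
    and le: "a \<le> a'" "c \<le> c'" "d \<le> d'"
  shows "A \<inter> B \<noteq> {}"
proof -
  note chA = lattice_path_chain_between[OF A, unfolded chain_between_iff]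
  note chB = lattice_path_chain_between[OF B, unfolded chain_between_iff]
  have endA: "a \<le> c'" "d' \<le> n" and endB: "a' \<le> c" "d \<le> n"
    using chA chB by (auto simp: point_le_def)
  \<comment> \<open>Both paths have a point of every rank from \<open>s\<close> to \<open>e\<close>:
    \<open>s\<close> is the later start because \<open>a \<le> a'\<close>, and \<open>e\<close> is
    the earlier end. That \<open>s \<le> e\<close> uses \<open>a' \<le> c \<le> c'\<close>, where
    \<open>a' \<le> c\<close> comes from the existence of \<open>B\<close>.\<close>
  define s where "s = rank (a', n)"
  define e where "e = min (rank (c, d)) (rank (c', d'))"
  define f where "f k = int (abscissa A (s + int k)) - int (abscissa B (s + int k))" for k
  have s: "rank (a, n) \<le> s" "rank (a', n) \<le> s" and e: "e \<le> rank (c, d)" "e \<le> rank (c', d')" "s \<le> e"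
    using le endA endB by (auto simp: s_def e_def rank_def)
  obtain l where l: "e = s + int l"
    using e(3) zle_iff_zadd by auto
  have "\<exists>k\<le>l. f k = 0"
  proof (rule nat0_intermed_int_val)
    show "\<forall>k<l. \<bar>f (k + 1) - f k\<bar> \<le> 1"
    proof (intro allI impI)
      fix k assume "k < l"
      then show "\<bar>f (k + 1) - f k\<bar> \<le> 1"
        using abscissa_step[OF A, of "s + int k"] abscissa_step[OF B, of "s + int k"] s e l
        by (auto simp: f_def algebra_simps)
    qed
    obtain p where p: "p \<in> A" "rank p = s" "fst p = abscissa A s"
      using lattice_path_rank_point[OF A s(1)] e by (metis order.trans)
    \<comment> \<open>At the fixed rank \<open>s\<close>, height at most \<open>n\<close> means
      abscissa at most \<open>a'\<close>.\<close>
    have "snd p \<le> n"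
      using p(1) chA by (auto simp: point_le_def)
    moreover have "abscissa B s = a'"
      using abscissa_eq[OF B, of "(a', n)"] chB by (simp add: s_def)
    ultimately show "f 0 \<le> 0"
      using p(2,3) by (simp add: f_def s_def rank_def)
    show "0 \<le> f l"
    \<comment> \<open>If \<open>B\<close> ends first, the point of \<open>A\<close> at that rank has
      height at least \<open>d' \<ge> d\<close>, hence abscissa at least \<open>c\<close>. Otherwise
      \<open>A\<close> has reached \<open>c' \<ge> c\<close>, while \<open>B\<close> never passes
      \<open>c\<close>.\<close>
    proof (cases "rank (c, d) \<le> rank (c', d')")
      case True
      then have eq: "e = rank (c, d)"
        by (simp add: e_def)
      obtain p where p: "p \<in> A" "rank p = e" "fst p = abscissa A e"
        using lattice_path_rank_point[OF A] s e by (metis order.trans)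
      have "d' \<le> snd p"
        using p(1) chA by (auto simp: point_le_def)
      moreover have "abscissa B e = c"
        using abscissa_eq[OF B, of "(c, d)"] chB by (simp add: eq)
      ultimately show ?thesis
        using p(2,3) le unfolding f_def l[symmetric] by (simp add: eq rank_def)
    next
      case False
      then have eq: "e = rank (c', d')"
        by (simp add: e_def)
      obtain p where p: "p \<in> B" "rank p = e" "fst p = abscissa B e"
        using lattice_path_rank_point[OF B] s e by (metis order.trans)
      have "fst p \<le> c"
        using p(1) chB by (auto simp: point_le_def)
      moreover have "abscissa A e = c'"
        using abscissa_eq[OF A, of "(c', d')"] chA by (simp add: eq)
      ultimately show ?thesis
        using p(3) le unfolding f_def l[symmetric] by simp
    qed
  qed
  then obtain k where k: "k \<le> l" "f k = 0"
    by blast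
  let ?t = "s + int k"
  have t: "s \<le> ?t" "?t \<le> e"
    using k l by auto
  obtain p where p: "p \<in> A" "rank p = ?t" "fst p = abscissa A ?t"
    using lattice_path_rank_point[OF A, of ?t] s e t by (metis order.trans)
  obtain q where q: "q \<in> B" "rank q = ?t" "fst q = abscissa B ?t"
    using lattice_path_rank_point[OF B, of ?t] s e t by (metis order.trans)
  have "p = q"
    using p q k(2) by (intro rank_inj) (simp_all add: f_def)
  with p q show ?thesis
    by blast
qed

section \<open>Inversions, index shift and evaluation of the determinant\<close>

lemma permutes_nonid_inversion:
  fixes \<sigma> :: "nat \<Rightarrow> nat"
  assumes \<sigma>: "\<sigma> permutes I" "\<sigma> \<noteq> id"
  obtains i j where "i \<in> I" "j \<in> I" "i < j" "\<sigma> j < \<sigma> i"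
proof -
  \<comment> \<open>All smaller indices are fixed, so by injectivity both \<open>\<sigma> i\<close>
    and the preimage \<open>j\<close> of \<open>i\<close> exceed \<open>i\<close>. Thus
    \<open>i\<close> and \<open>j\<close> form an inversion.\<close>
  define i where "i = (LEAST k. \<sigma> k \<noteq> k)"
  have "\<exists>k. \<sigma> k \<noteq> k"
    using \<sigma>(2) by (auto simp: fun_eq_iff)
  then have i: "\<sigma> i \<noteq> i"
    unfolding i_def by (rule LeastI_ex)
  have min: "\<sigma> k = k" if "k < i" for k
    using that not_less_Least unfolding i_def by blast
  have inj: "\<sigma> k = \<sigma> l \<Longrightarrow> k = l" for k l
    using permutes_inj[OF \<sigma>(1)] by (simp add: inj_eq)
  obtain j where j: "\<sigma> j = i"
    using permutes_surj[OF \<sigma>(1)] by (metis surjD)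
  have "i < \<sigma> i"
    using i min[of "\<sigma> i"] inj by (metis linorder_neqE_nat)
  moreover have "i < j"
    using i j min[of j] by (metis linorder_neqE_nat)
  moreover have "i \<in> I" "j \<in> I"
    using i j \<sigma>(1) by (metis permutes_def)+
  ultimately show thesis
    using j that by simp
qed

text \<open>Matrix indices start at 0 and the tuples at 1. The restricted lambdas keep the shifted
  families extensional, so the two shifts are mutually inverse.\<close>

lemma card_nonintersecting_tuples_shift:
  "card (nonintersecting_tuples m n Y r P Q) =
    card {C \<in> path_tuples m n Y {0..<r} (P \<circ> Suc) (Q \<circ> Suc). disjoint_family_on C {0..<r}}"
proof (rule bij_betw_same_card)
  have disj1: "disjoint_family_on (\<lambda>k\<in>{0..<r}. C (Suc k)) {0..<r}"
    if "disjoint_family_on C {1..r}" for C :: "nat \<Rightarrow> point set"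
    using that by (auto simp: disjoint_family_on_def)
  have disj2: "disjoint_family_on (\<lambda>k\<in>{1..r}. C (k - 1)) {1..r}"
    if "disjoint_family_on C {0..<r}" for C :: "nat \<Rightarrow> point set"
    unfolding disjoint_family_on_def
  proof (intro ballI impI)
    fix k l assume kl: "k \<in> {1..r}" "l \<in> {1..r}" "k \<noteq> l"
    then have "k - 1 \<noteq> l - 1" "k - 1 \<in> {0..<r}" "l - 1 \<in> {0..<r}"
      by auto
    with kl show "(\<lambda>k\<in>{1..r}. C (k - 1)) k \<inter> (\<lambda>k\<in>{1..r}. C (k - 1)) l = {}"
      using disjoint_family_onD[OF that, of "k - 1" "l - 1"] by simp
  qed
  have shift: "C (k - Suc 0) \<in> paths_in m n Y (P k) (Q k)"
    if "C \<in> path_tuples m n Y {0..<r} (P \<circ> Suc) (Q \<circ> Suc)" "k \<in> {1..r}" for C k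
    using PiE_mem[OF that(1)[unfolded path_tuples_def], of "k - 1"] that(2) by auto
  show "bij_betw (\<lambda>C. \<lambda>k\<in>{0..<r}. C (Suc k)) (nonintersecting_tuples m n Y r P Q)
    {C \<in> path_tuples m n Y {0..<r} (P \<circ> Suc) (Q \<circ> Suc). disjoint_family_on C {0..<r}}"
  proof (rule bij_betw_byWitness[where f' = "\<lambda>C. \<lambda>k\<in>{1..r}. C (k - 1)"])
    show "\<forall>C\<in>nonintersecting_tuples m n Y r P Q.
        (\<lambda>k\<in>{1..r}. (\<lambda>k\<in>{0..<r}. C (Suc k)) (k - 1)) = C"
      by (auto simp: nonintersecting_tuples_def PiE_def extensional_def fun_eq_iff)
    show "\<forall>C\<in>{C \<in> path_tuples m n Y {0..<r} (P \<circ> Suc) (Q \<circ> Suc). disjoint_family_on C {0..<r}}.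
        (\<lambda>k\<in>{0..<r}. (\<lambda>k\<in>{1..r}. C (k - 1)) (Suc k)) = C"
      by (auto simp: path_tuples_def PiE_def extensional_def fun_eq_iff)
  qed (use disj1 disj2 shift in \<open>auto simp: nonintersecting_tuples_def path_tuples_def PiE_mem\<close>)
qed

theorem theorem1p2:
  fixes m n r :: nat
    and Y :: "point set"
    and P Q :: "nat \<Rightarrow> point"
    and a c d :: "nat \<Rightarrow> nat"
  assumes "1 \<le> r" and "r \<le> m" and "m \<le> n"
    and "two_sided_subregion m n Y"
    and "\<forall>i\<in>{1..r}. P i \<in> Y \<and> Q i \<in> Y"
    and "\<forall>i\<in>{1..r}. P i = (a i, n)"
    and "a 1 = 1" and "strict_mono_on {1..r} a" and "a r \<le> m"
    and "\<forall>i\<in>{1..r}. Q i = (c i, d i)"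
    and "1 \<le> c 1" and "mono_on {1..r} c" and "c r = m"
    and "d 1 = 1" and "strict_mono_on {1..r} d" and "d r \<le> n"
    and "(1, 1) \<notin> Y \<longrightarrow> (c 1 - 1, 1) \<in> Y"
  shows "int (card (nonintersecting_tuples m n Y r P Q))
       = det (mat r r (\<lambda>(i, j). int (path_count m n Y (P (Suc i)) (Q (Suc j)))))"
proof -
  let ?I = "{0..<r}"
  let ?p = "P \<circ> Suc" and ?q = "Q \<circ> Suc"
  let ?N = "\<lambda>\<sigma>. {C \<in> path_tuples m n Y ?I ?p (?q \<circ> \<sigma>). disjoint_family_on C ?I}"
  \<comment> \<open>An inversion of \<open>\<sigma>\<close> yields two paths whose endpoints are
    exchanged in the weak sense of \<open>lattice_paths_meet\<close>, so no tuple for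
    \<open>\<sigma>\<close> is disjoint.\<close>
  have none: "?N \<sigma> = {}" if \<sigma>: "\<sigma> permutes ?I" "\<sigma> \<noteq> id" for \<sigma>
  proof -
    obtain i j where ij: "i \<in> ?I" "j \<in> ?I" "i < j" "\<sigma> j < \<sigma> i"
      using permutes_nonid_inversion[OF \<sigma>] .
    have \<sigma>I: "\<sigma> i < r" "\<sigma> j < r"
      using ij(1,2) permutes_in_image[OF \<sigma>(1)] by auto
    have le: "a (Suc i) \<le> a (Suc j)" "c (Suc (\<sigma> j)) \<le> c (Suc (\<sigma> i))"
      "d (Suc (\<sigma> j)) \<le> d (Suc (\<sigma> i))"
      using ij \<sigma>I strict_mono_onD[OF assms(8), of "Suc i" "Suc j"]
        mono_onD[OF assms(12), of "Suc (\<sigma> j)" "Suc (\<sigma> i)"]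
        strict_mono_onD[OF assms(15), of "Suc (\<sigma> j)" "Suc (\<sigma> i)"]
      by auto
    have "C i \<inter> C j \<noteq> {}" if "C \<in> path_tuples m n Y ?I ?p (?q \<circ> \<sigma>)" for C
    proof -
      have "C k \<in> paths_in m n Y (a (Suc k), n) (c (Suc (\<sigma> k)), d (Suc (\<sigma> k)))"
        if "k \<in> ?I" "\<sigma> k < r" for k
        using PiE_mem[OF \<open>C \<in> _\<close>[unfolded path_tuples_def] that(1)] that assms(6,10) by simp
      then show ?thesis
        using lattice_paths_meet[OF _ _ le] ij \<sigma>I unfolding paths_in_def by blast
    qed
    then show ?thesis
      using ij(1,2,3) disjoint_family_onD[of _ ?I i j] by blast
  qed
  have "det (mat r r (\<lambda>(i, j). int (path_count m n Y (P (Suc i)) (Q (Suc j))))) =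
      (\<Sum>\<sigma> | \<sigma> permutes ?I. sign \<sigma> * (\<Prod>i\<in>?I. int (path_count m n Y (?p i) (?q (\<sigma> i)))))"
    unfolding det_def
    by (auto intro!: sum.cong prod.cong arg_cong2[where f = "(*)"] simp: permutes_in_image)
  also have "\<dots> = (\<Sum>\<sigma> | \<sigma> permutes ?I. sign \<sigma> * int (card (?N \<sigma>)))"
    by (rule lindstroem_gessel_viennot) simp
  also have "\<dots> = (\<Sum>\<sigma>\<in>{id}. sign \<sigma> * int (card (?N \<sigma>)))"
    by (rule sum.mono_neutral_right) (simp_all add: finite_permutations permutes_id none)
  also have "\<dots> = int (card (nonintersecting_tuples m n Y r P Q))"
    by (simp add: sign_id card_nonintersecting_tuples_shift)
  finally show ?thesis ..
qed

end
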